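(* Let $\varepsilon>0$. (a) For any $\alpha>0$ there is a champagne subregion $\Omega=B\setminus E$, $E=\bigcup_{k=1}^\infty\overline{B}(x_k,r_k)$, of the unit disc $B\subset\mathbb{R}^2$ such that $\sum_k r_k^{\alpha}<\varepsilon$ and $E$ is unavoidable. (b) For any $\alpha>1$ there is a champagne subregion $\Omega=B\setminus E$, $E=\bigcup_{k=1}^\infty\overline{B}(x_k,r_k)$, of the unit disc $B\subset\mathbb{R}^2$ such that $$\sum_k\left\{\log\frac{1}{r_k}\right\}^{-\alpha}<\varepsilon$$ and $E$ is unavoidable.
   Context: $B(x,r)$ denotes the open disc in $\mathbb{R}^2$ of centre $x$ and radius $r>0$, and $B=B(0,1)$. Let $(\overline{B}(x_k,r_k))_{k\ge 1}$ be a sequence of pairwise disjoint closed discs, with $x_k\in B$ and $r_k>0$, such that $|x_k|\to 1$ and $\sup_k r_k/(1-|x_k|)<1$. Put $E=\bigcup_{k=1}^\infty\overline{B}(x_k,r_k)$. The set $\Omega=B\setminus E$ is called a champagne subregion of the unit disc; it is assumed throughout that $0\in\Omega$. The set $E$ is called unavoidable if it carries full harmonic measure with respect to $\Omega$, that is, the harmonic measure of $\partial B$ relative to $\Omega$ is zero. *)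

theory Defs
  imports "HOL-Analysis.Analysis"
begin

text \<open>
  The plane is identified with \<open>complex\<close>, whose norm and topology are the Euclidean ones.

  Mean value over the circle of centre \<open>c\<close> and radius \<open>\<rho>\<close> with respect to normalised arc length,
  as the integral of the positive part minus that of the negative part (\<open>e2ennreal\<close> sends negative
  values to \<open>0\<close>). It is only applied to lower semicontinuous functions with values in
  \<open>(-\<infinity>, \<infinity>]\<close>; these are bounded below on the circle, so the second integral is finite.
\<close>

definition circle_mean :: "(complex \<Rightarrow> ereal) \<Rightarrow> complex \<Rightarrow> real \<Rightarrow> ereal" where
  "circle_mean u c \<rho> =
     (enn2ereal (\<integral>\<^sup>+ t\<in>{0..2 * pi}. e2ennreal (u (c + rcis \<rho> t)) \<partial>lborel)
      - enn2ereal (\<integral>\<^sup>+ t\<in>{0..2 * pi}. e2ennreal (- u (c + rcis \<rho> t)) \<partial>lborel))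
     / ereal (2 * pi)"

text \<open>
  Hyperharmonic functions on an open set: superharmonic functions, except that the value
  \<open>\<infinity>\<close> is allowed identically on components.
\<close>

definition hyperharmonic_on :: "complex set \<Rightarrow> (complex \<Rightarrow> ereal) \<Rightarrow> bool" where
  "hyperharmonic_on \<Omega> u \<longleftrightarrow>
     (\<forall>z\<in>\<Omega>. u z \<noteq> -\<infinity>) \<and>
     (\<forall>z\<in>\<Omega>. u z \<le> Liminf (at z within \<Omega>) u) \<and>
     (\<forall>z \<rho>. 0 < \<rho> \<longrightarrow> cball z \<rho> \<subseteq> \<Omega> \<longrightarrow> circle_mean u z \<rho> \<le> u z)"

text \<open>The Perron--Wiener--Brelot upper class and upper solution for a bounded open set.\<close>

definition upper_class :: "complex set \<Rightarrow> (complex \<Rightarrow> ereal) \<Rightarrow> (complex \<Rightarrow> ereal) set" where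
  "upper_class \<Omega> f =
     {u. hyperharmonic_on \<Omega> u \<and>
         (\<exists>b::real. \<forall>z\<in>\<Omega>. ereal b \<le> u z) \<and>
         (\<forall>\<zeta>\<in>frontier \<Omega>. f \<zeta> \<le> Liminf (at \<zeta> within \<Omega>) u)}"

definition upper_solution :: "complex set \<Rightarrow> (complex \<Rightarrow> ereal) \<Rightarrow> complex \<Rightarrow> ereal" where
  "upper_solution \<Omega> f z = (INF u\<in>upper_class \<Omega> f. u z)"

text \<open>
  Harmonic measure at \<open>z\<close> of a Borel set \<open>A\<close>, relative to the bounded open set \<open>\<Omega>\<close>: the generalised
  solution of the Dirichlet problem with the indicator of \<open>A\<close> as boundary data. Such data are
  resolutive, so the upper solution is the solution. Only \<open>A \<inter> frontier \<Omega>\<close> matters.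
\<close>

definition harmonic_measure :: "complex set \<Rightarrow> complex \<Rightarrow> complex set \<Rightarrow> ereal" where
  "harmonic_measure \<Omega> z A = upper_solution \<Omega> (indicator A) z"

definition bubbles :: "(nat \<Rightarrow> complex) \<Rightarrow> (nat \<Rightarrow> real) \<Rightarrow> complex set" where
  "bubbles x r = (\<Union>k. cball (x k) (r k))"

text \<open>
  The sequence is indexed from \<open>0\<close>. The supremum is taken in \<open>ereal\<close>, so that its being less than
  \<open>1\<close> includes boundedness.
\<close>

definition champagne_data :: "(nat \<Rightarrow> complex) \<Rightarrow> (nat \<Rightarrow> real) \<Rightarrow> bool" where
  "champagne_data x r \<longleftrightarrow>
     (\<forall>k. x k \<in> ball 0 1) \<and>
     (\<forall>k. 0 < r k) \<and>
     disjoint_family (\<lambda>k. cball (x k) (r k)) \<and>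
     (\<lambda>k. norm (x k)) \<longlonglongrightarrow> 1 \<and>
     (SUP k. ereal (r k / (1 - norm (x k)))) < 1 \<and>
     0 \<in> ball 0 1 - bubbles x r"

definition unavoidable :: "complex set \<Rightarrow> bool" where
  "unavoidable E \<longleftrightarrow>
     (\<forall>z \<in> ball 0 1 - E. harmonic_measure (ball 0 1 - E) z (sphere 0 1) = 0)"

end

theory Submission
  imports Defs "HOL-Complex_Analysis.Complex_Analysis" "HOL-Real_Asymp.Real_Asymp"
begin

text \<open>
  Fix \<open>\<rho> < 1\<close> and place \<open>N\<close> discs of radius \<open>s\<close> at the points \<open>\<rho> \<omega>\<close> with \<open>\<omega>\<^sup>N = 1\<close>. The function
  \<open>ln \<bar>z\<^sup>N - \<rho>\<^sup>N\<bar>\<close> is harmonic off the centres, at least \<open>ln (\<rho>\<^sup>N s)\<close> off the discs, about \<open>0\<close> on the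
  unit circle, and at most \<open>ln (2 \<rho>\<^sup>N)\<close> on \<open>\<bar>z\<bar> \<le> \<rho>\<close>. Normalised, it shows that seen from
  \<open>\<bar>z\<bar> \<le> \<rho>\<close> the unit circle has harmonic measure of order \<open>\<eta>\<close> as soon as
  \<open>ln (1/s) = \<eta> N ln (1/\<rho>)\<close>. The number \<open>N\<close> is still free: the contribution
  \<open>N (ln (1/s))\<^bsup>-\<alpha>\<^esup>\<close> of the ring to the sum is of order \<open>N\<^bsup>1-\<alpha>\<^esup>\<close>, which is arbitrarily small for
  \<open>N\<close> large. Now take a sequence of such rings with \<open>\<rho> \<rightarrow> 1\<close> and \<open>\<eta> \<rightarrow> 0\<close>.
\<close>

section \<open>Circle means of harmonic and quadratic functions\<close>

lemma ennreal_max0: "ennreal (max 0 x) = ennreal x"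
  by (cases "0 \<le> x") (auto simp: max_def ennreal_neg)

text \<open>Used in both directions with \<open>antisym\<close>, this shows that a circle mean
  depends only on the values on the circle; used with hyperharmonic \<open>v\<close>, it bounds the
  mean below by an explicit one.\<close>

lemma circle_mean_mono:
  assumes "\<And>z. z \<in> sphere c \<rho> \<Longrightarrow> u z \<le> v z" "0 \<le> \<rho>"
  shows "circle_mean u c \<rho> \<le> circle_mean v c \<rho>"
proof -
  have le: "u (c + rcis \<rho> t) \<le> v (c + rcis \<rho> t)" for t
    using assms(2) by (intro assms(1)) (simp add: dist_norm)
  have "(\<integral>\<^sup>+ t\<in>{0..2 * pi}. e2ennreal (u (c + rcis \<rho> t)) \<partial>lborel)
      \<le> (\<integral>\<^sup>+ t\<in>{0..2 * pi}. e2ennreal (v (c + rcis \<rho> t)) \<partial>lborel)"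
    by (intro nn_integral_mono mult_right_mono e2ennreal_mono le) simp
  moreover have "(\<integral>\<^sup>+ t\<in>{0..2 * pi}. e2ennreal (- v (c + rcis \<rho> t)) \<partial>lborel)
      \<le> (\<integral>\<^sup>+ t\<in>{0..2 * pi}. e2ennreal (- u (c + rcis \<rho> t)) \<partial>lborel)"
    by (intro nn_integral_mono mult_right_mono e2ennreal_mono) (simp_all add: le)
  ultimately show ?thesis
    unfolding circle_mean_def
    by (intro ereal_divide_right_mono ereal_minus_mono) (simp_all add: less_eq_ennreal.rep_eq)
qed

text \<open>Splitting \<open>h\<close> along the circle into positive and negative parts turns each
  nonnegative Lebesgue integral of \<open>circle_mean\<close> into a real integral. Both are finite,
  so the subtraction in \<open>ereal\<close> is that of the reals.\<close>

lemma circle_mean_has_integral: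
  assumes "0 \<le> \<rho>" "continuous_on (sphere c \<rho>) h"
    and int: "((\<lambda>t. h (c + rcis \<rho> t)) has_integral I) {0..2 * pi}"
  shows "circle_mean (\<lambda>z. ereal (h z)) c \<rho> = ereal (I / (2 * pi))"
proof -
  define H where "H = (\<lambda>t. h (c + rcis \<rho> t))"
  define P where "P = integral {0..2 * pi} (\<lambda>t. max 0 (H t))"
  define M where "M = integral {0..2 * pi} (\<lambda>t. max 0 (- H t))"
  have "continuous_on {0..2 * pi} H"
    unfolding H_def rcis_def
    by (rule continuous_on_compose2[OF assms(2)])
      (use assms(1) in \<open>auto intro!: continuous_intros simp: dist_norm norm_mult\<close>)
  then have "continuous_on {0..2 * pi} (\<lambda>t. max 0 (H t))"
            "continuous_on {0..2 * pi} (\<lambda>t. max 0 (- H t))"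
    by (intro continuous_intros; assumption)+
  then have P: "((\<lambda>t. max 0 (H t)) has_integral P) {0..2 * pi}"
    and M: "((\<lambda>t. max 0 (- H t)) has_integral M) {0..2 * pi}"
    unfolding P_def M_def by (simp_all only: has_integral_integral[symmetric] integrable_continuous_real)
  have "((\<lambda>t. max 0 (H t) - max 0 (- H t)) has_integral P - M) {0..2 * pi}"
    by (rule has_integral_diff[OF P M])
  also have "(\<lambda>t. max 0 (H t) - max 0 (- H t)) = H"
    by (auto simp: max_def)
  finally have PM: "P - M = I"
    using int has_integral_unique unfolding H_def by blast
  have "0 \<le> P" "0 \<le> M"
    by (auto intro!: has_integral_nonneg[OF P] has_integral_nonneg[OF M])
  \<comment> \<open>\<open>e2ennreal\<close> truncates negative values to 0, so the integrand is the
    positive part, whose integral is \<open>P\<close>.\<close>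
  have "(\<integral>\<^sup>+ t\<in>{0..2 * pi}. e2ennreal (ereal (H t)) \<partial>lborel) = ennreal P"
    using nn_integral_has_integral_lebesgue'[OF _ P] by (simp only: ennreal_max0 e2ennreal_ereal max.cobounded1)
  moreover have "(\<integral>\<^sup>+ t\<in>{0..2 * pi}. e2ennreal (- ereal (H t)) \<partial>lborel) = ennreal M"
    using nn_integral_has_integral_lebesgue'[OF _ M]
    by (simp only: ennreal_max0 e2ennreal_ereal max.cobounded1 uminus_ereal.simps)
  ultimately show ?thesis
    using \<open>0 \<le> P\<close> \<open>0 \<le> M\<close> PM by (simp add: circle_mean_def H_def)
qed

text \<open>Cauchy's integral formula at the centre: in the parametrisation, du / (u - c) becomes i
  dt, and the factor i is removed at the end by multiplying with -i.\<close>

lemma has_integral_circle_holomorphic: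
  fixes f :: "complex \<Rightarrow> complex"
  assumes "0 < \<rho>" "f holomorphic_on cball c \<rho>"
  shows "((\<lambda>t. f (c + rcis \<rho> t)) has_integral (2 * pi) * f c) {0..2 * pi}"
proof -
  have "((\<lambda>u. f u / (u - c)) has_contour_integral (2 * of_real pi * \<i> * f c)) (circlepath c \<rho>)"
    by (rule Cauchy_integral_circlepath_simple) (use assms in auto)
  then have "((\<lambda>t. f (c + \<rho> * cis t) / (c + \<rho> * cis t - c) * \<rho> * \<i> * cis t)
      has_integral (2 * of_real pi * \<i> * f c)) {0..2 * pi}"
    unfolding circlepath_def by (subst (asm) has_contour_integral_part_circlepath_iff) auto
  then have "((\<lambda>t. f (c + \<rho> * cis t) * \<i>) has_integral (2 * of_real pi * \<i> * f c)) {0..2 * pi}"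
    by (rule has_integral_eq[rotated]) (use assms(1) in simp)
  from has_integral_mult_left[OF this, of "- \<i>"] show ?thesis
    by (simp add: rcis_def mult_ac flip: mult.assoc[of \<i> \<i>])
qed

lemma circle_mean_Re_holomorphic:
  assumes "0 < \<rho>" "f holomorphic_on cball c \<rho>"
  shows "circle_mean (\<lambda>z. ereal (Re (f z))) c \<rho> = ereal (Re (f c))"
proof -
  have "continuous_on (sphere c \<rho>) (\<lambda>z. Re (f z))"
    using holomorphic_on_imp_continuous_on[OF assms(2)]
    by (intro continuous_intros) (rule continuous_on_subset, auto)
  moreover have "((\<lambda>t. Re (f (c + rcis \<rho> t))) has_integral (2 * pi) * Re (f c)) {0..2 * pi}"
    using has_integral_Re[OF has_integral_circle_holomorphic[OF assms]] by simp
  ultimately show ?thesis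
    using circle_mean_has_integral[of \<rho> c "\<lambda>z. Re (f z)"] assms(1) by simp
qed

text \<open>On the circle, |z|^2 = |c|^2 + \<rho>^2 + 2 Re (cnj c (z - c)), the real part of an
  affine holomorphic function, so the mean is the value of that function at \<open>c\<close>. The
  surplus b \<rho>^2 over the value at the centre drives the minimum principle.\<close>

lemma circle_mean_cmod_square:
  assumes "0 < \<rho>"
  shows "circle_mean (\<lambda>z. ereal (a + b * (cmod z)\<^sup>2)) c \<rho> = ereal (a + b * ((cmod c)\<^sup>2 + \<rho>\<^sup>2))"
proof -
  define f where "f = (\<lambda>z. complex_of_real (a + b * ((cmod c)\<^sup>2 + \<rho>\<^sup>2)) + 2 * b * cnj c * (z - c))"
  have eq: "a + b * (cmod z)\<^sup>2 = Re (f z)" if "z \<in> sphere c \<rho>" for z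
  proof -
    have "\<rho>\<^sup>2 = (cmod (z - c))\<^sup>2"
      using that by (simp add: dist_norm norm_minus_commute)
    then have "(cmod z)\<^sup>2 = (cmod c)\<^sup>2 + \<rho>\<^sup>2 + 2 * Re (cnj c * (z - c))"
      unfolding cmod_power2 by (simp add: algebra_simps power2_eq_square)
    then show ?thesis
      by (simp add: f_def distrib_left)
  qed
  have "circle_mean (\<lambda>z. ereal (a + b * (cmod z)\<^sup>2)) c \<rho> = circle_mean (\<lambda>z. ereal (Re (f z))) c \<rho>"
    using assms by (intro antisym circle_mean_mono) (auto simp: eq)
  also have "\<dots> = ereal (Re (f c))"
    using assms by (intro circle_mean_Re_holomorphic) (auto simp: f_def intro!: holomorphic_intros)
  finally show ?thesis by (simp add: f_def)
qed

text \<open>A nonvanishing holomorphic function has a holomorphic logarithm \<open>g\<close> on a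
  disc slightly larger than \<open>cball c \<rho>\<close>, and ln |f| = Re g on the closed
  disc.\<close>

lemma circle_mean_ln_cmod_holomorphic:
  assumes "0 < \<rho>" "open U" "cball c \<rho> \<subseteq> U" "f holomorphic_on U" "\<And>z. z \<in> U \<Longrightarrow> f z \<noteq> 0"
  shows "circle_mean (\<lambda>z. ereal (a + b * ln (cmod (f z)))) c \<rho> = ereal (a + b * ln (cmod (f c)))"
proof -
  obtain e where e: "0 < e" "(\<Union>x\<in>cball c \<rho>. ball x e) \<subseteq> U"
    using compact_subset_open_imp_ball_epsilon_subset[OF compact_cball assms(2,3)] by blast
  have "ball c (\<rho> + e) \<subseteq> U"
  proof
    fix z assume z: "z \<in> ball c (\<rho> + e)"
    have "\<exists>x\<in>cball c \<rho>. dist x z < e"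
    proof (cases "dist c z \<le> \<rho>")
      case True
      then show ?thesis using e(1) by (intro bexI[of _ z]) auto
    next
      case False
      define d where "d = cmod (z - c)"
      have d: "\<rho> < d" "d < \<rho> + e"
        using False z by (auto simp: d_def dist_norm norm_minus_commute)
      \<comment> \<open>The radial projection of \<open>z\<close> onto the circle, at distance d -
        \<rho> < e from \<open>z\<close>.\<close>
      define x where "x = c + (\<rho> / d) *\<^sub>R (z - c)"
      have "x - z = (\<rho> / d - 1) *\<^sub>R (z - c)" by (simp add: x_def algebra_simps)
      then have "dist x z = \<bar>\<rho> / d - 1\<bar> * d" by (simp add: dist_norm d_def)
      also have "\<dots> = d - \<rho>" using d \<open>0 < \<rho>\<close> by (simp add: abs_if field_simps)
      finally have "dist x z < e" using d by simp
      moreover have "dist c x \<le> \<rho>"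
        using d \<open>0 < \<rho>\<close> by (simp add: x_def dist_norm d_def[symmetric])
      ultimately show ?thesis by auto
    qed
    then show "z \<in> U" using e(2) by (auto simp: subset_iff)
  qed
  then obtain g where g: "g holomorphic_on ball c (\<rho> + e)"
      "\<And>z. z \<in> ball c (\<rho> + e) \<Longrightarrow> exp (g z) = f z"
    using holomorphic_logarithm_exists[of "ball c (\<rho> + e)" f c] assms(1,5)
      holomorphic_on_subset[OF assms(4)] e(1) by (auto simp: subset_iff)
  have eq: "ln (cmod (f z)) = Re (g z)" if "z \<in> cball c \<rho>" for z
  proof -
    have "z \<in> ball c (\<rho> + e)" using that e(1) by auto
    then have "cmod (f z) = exp (Re (g z))" using g(2) norm_exp_eq_Re by metis
    then show ?thesis by simp
  qed
  have "circle_mean (\<lambda>z. ereal (a + b * ln (cmod (f z)))) c \<rho>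
      = circle_mean (\<lambda>z. ereal (Re (a + b * g z))) c \<rho>"
    using assms(1) by (intro antisym circle_mean_mono) (auto simp: eq)
  also have "\<dots> = ereal (Re (a + b * g c))"
    by (rule circle_mean_Re_holomorphic)
      (use assms(1) e(1) in \<open>auto intro!: holomorphic_intros holomorphic_on_subset[OF g(1)]\<close>)
  finally show ?thesis using eq[of c] assms(1) by simp
qed

section \<open>Minimum principle for hyperharmonic functions\<close>

text \<open>A minimising sequence for the perturbed function \<open>W\<close> has a limit point
  \<open>l\<close> in the closure. The boundary condition forces \<open>l\<close> into \<Omega>,
  lower semicontinuity makes it a minimum point of \<open>W\<close>, and the mean value inequality
  at \<open>l\<close> then fails.\<close>

lemma hyperharmonic_nonneg:
  assumes hyp: "hyperharmonic_on \<Omega> u" and "open \<Omega>" "bounded \<Omega>"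
    and bdd: "\<And>z. z \<in> \<Omega> \<Longrightarrow> ereal b \<le> u z"
    and bdry: "\<And>\<zeta>. \<zeta> \<in> frontier \<Omega> \<Longrightarrow> 0 \<le> Liminf (at \<zeta> within \<Omega>) u"
    and "z \<in> \<Omega>"
  shows "0 \<le> u z"
proof (rule ccontr)
  assume "\<not> 0 \<le> u z"
  obtain R where R: "0 < R" "\<And>w. w \<in> \<Omega> \<Longrightarrow> cmod w \<le> R"
    using \<open>bounded \<Omega>\<close> bounded_pos by blast
  have "\<exists>e>0. u z < ereal (- e)"
  proof -
    obtain y where "u z < ereal y" "ereal y < 0"
      using \<open>\<not> 0 \<le> u z\<close> ereal_dense2[of "u z" 0] by (auto simp: not_le)
    then show ?thesis by (intro exI[of _ "- y"]) auto
  qed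
  then obtain e where e: "0 < e" "u z < ereal (- e)" by blast
  \<comment> \<open>With this choice the perturbation is at most e/2 on \<Omega>, so near the
    boundary \<open>W\<close> cannot come close to its infimum, which is below -e.\<close>
  define \<delta> where "\<delta> = e / (2 * R\<^sup>2)"
  have \<delta>: "0 < \<delta>" "\<delta> * R\<^sup>2 = e / 2" using e R by (auto simp: \<delta>_def)
  have sq: "\<delta> * (cmod w)\<^sup>2 \<le> e / 2" if "w \<in> \<Omega>" for w
    using mult_left_mono[OF power_mono[OF R(2)[OF that] norm_ge_zero, of 2], of \<delta>] \<delta> by simp
  \<comment> \<open>Subtracting \<open>\<delta> \<bar>w\<bar>\<^sup>2\<close> makes \<open>u\<close> strictly superharmonic, so an interior minimum is impossible.\<close>
  define W where "W = (\<lambda>w. u w - ereal (\<delta> * (cmod w)\<^sup>2))"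
  define m where "m = (INF w\<in>\<Omega>. W w)"
  have "ereal (b - e / 2) \<le> m"
    unfolding m_def W_def
  proof (rule INF_greatest)
    fix w assume "w \<in> \<Omega>"
    then show "ereal (b - e / 2) \<le> u w - ereal (\<delta> * (cmod w)\<^sup>2)"
      using bdd[of w] sq[of w] by (cases "u w") auto
  qed
  moreover have "m \<le> W z" unfolding m_def using \<open>z \<in> \<Omega>\<close> by (rule INF_lower)
  moreover have "W z \<le> u z"
    unfolding W_def using \<delta>(1) by (cases "u z") auto
  ultimately have "ereal (b - e / 2) \<le> m" "m < ereal (- e)"
    using e(2) by (auto intro: order.strict_trans1)
  then obtain m' where m': "m = ereal m'" "m' < - e"
    by (cases m) auto
  have "\<exists>w\<in>\<Omega>. W w < ereal (m' + 1 / Suc n)" for n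
    using INF_less_iff[of W \<Omega> "ereal (m' + 1 / Suc n)"] m' unfolding m_def by simp
  then obtain s where s: "\<And>n. s n \<in> \<Omega>" "\<And>n. W (s n) < ereal (m' + 1 / Suc n)" by metis
  have "compact (closure \<Omega>)" using \<open>bounded \<Omega>\<close> by simp
  then obtain l r where l: "l \<in> closure \<Omega>" "strict_mono r" "(s \<circ> r) \<longlonglongrightarrow> l"
    using s(1) closure_subset unfolding compact_def by (meson subset_iff)
  have eps: "(\<lambda>n. 1 / real (Suc (r n))) \<longlonglongrightarrow> 0"
    using LIMSEQ_subseq_LIMSEQ[OF LIMSEQ_inverse_real_of_nat l(2)] by (simp add: o_def inverse_eq_divide)
  have us: "u (s n) \<le> ereal (m' + 1 / Suc n + \<delta> * (cmod (s n))\<^sup>2)" for n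
    using s(2)[of n] unfolding W_def by (cases "u (s n)") auto
  have lim: "(\<lambda>n. m' + 1 / Suc (r n) + \<delta> * (cmod (s (r n)))\<^sup>2) \<longlonglongrightarrow> m' + \<delta> * (cmod l)\<^sup>2"
  proof -
    have "(\<lambda>n. m' + 1 / Suc (r n) + \<delta> * (cmod (s (r n)))\<^sup>2) \<longlonglongrightarrow> m' + 0 + \<delta> * (cmod l)\<^sup>2"
      using l(3) unfolding o_def by (intro tendsto_add tendsto_const eps tendsto_mult tendsto_power tendsto_norm)
    then show ?thesis by simp
  qed
  \<comment> \<open>A lower bound for \<open>u\<close> near \<open>l\<close> survives in the limit
    along the minimising sequence. The filter \<open>at l within \<Omega>\<close> omits
    \<open>l\<close> itself, which the sequence may hit; hence the second premise.\<close>
  have key: "y \<le> m' + \<delta> * (cmod l)\<^sup>2"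
    if "eventually (\<lambda>w. ereal y < u w) (at l within \<Omega>)" "l \<in> \<Omega> \<Longrightarrow> ereal y < u l" for y
  proof -
    have "eventually (\<lambda>w. w \<in> \<Omega> \<longrightarrow> ereal y < u w) (nhds l)"
      using that(1) unfolding eventually_at_filter by (rule eventually_mono) (use that(2) in auto)
    then have "eventually (\<lambda>n. s (r n) \<in> \<Omega> \<longrightarrow> ereal y < u (s (r n))) sequentially"
      using eventually_compose_filterlim[OF _ l(3)] by simp
    then have "eventually (\<lambda>n. y \<le> m' + 1 / Suc (r n) + \<delta> * (cmod (s (r n)))\<^sup>2) sequentially"
    proof eventually_elim
      case (elim n)
      then have "ereal y < u (s (r n))" using s(1) by simp
      also note us[of "r n"]
      finally show ?case by simp
    qed
    then show ?thesis using tendsto_lowerbound[OF lim] by simp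
  qed
  have "l \<in> \<Omega>"
  proof (rule ccontr)
    assume "l \<notin> \<Omega>"
    then have "l \<in> frontier \<Omega>" using l(1) \<open>open \<Omega>\<close> by (simp add: frontier_def interior_open)
    then have "eventually (\<lambda>w. ereal (- e / 2) < u w) (at l within \<Omega>)"
      using bdry[of l] e(1) unfolding le_Liminf_iff by simp
    then have "- e / 2 \<le> m' + \<delta> * (cmod l)\<^sup>2" using \<open>l \<notin> \<Omega>\<close> by (intro key) auto
    moreover have "cmod l \<le> R"
      using l(3) R(2) s(1) by (intro LIMSEQ_le_const2[OF tendsto_norm[OF l(3)]]) auto
    then have "\<delta> * (cmod l)\<^sup>2 \<le> e / 2"
      using mult_left_mono[OF power_mono[of "cmod l" R 2], of \<delta>] \<delta> by simp
    ultimately show False using m' e(1) by linarith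
  qed
  have ul: "u l \<le> ereal (m' + \<delta> * (cmod l)\<^sup>2)"
  proof (rule ccontr)
    assume "\<not> ?thesis"
    then obtain y where y: "ereal (m' + \<delta> * (cmod l)\<^sup>2) < ereal y" "ereal y < u l"
      using ereal_dense2[of "ereal (m' + \<delta> * (cmod l)\<^sup>2)" "u l"] unfolding not_le by blast
    have "u l \<le> Liminf (at l within \<Omega>) u"
      using hyp \<open>l \<in> \<Omega>\<close> unfolding hyperharmonic_on_def by blast
    then have "y \<le> m' + \<delta> * (cmod l)\<^sup>2"
      using y(2) unfolding le_Liminf_iff by (intro key) auto
    then show False using y(1) by simp
  qed
  obtain \<rho> where \<rho>: "0 < \<rho>" "cball l \<rho> \<subseteq> \<Omega>"
    using \<open>open \<Omega>\<close> \<open>l \<in> \<Omega>\<close> open_contains_cball by blast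
  \<comment> \<open>On the circle u \<ge> m' + \<delta> |w|^2, and the mean of the right-hand side
    exceeds its value at \<open>l\<close> by \<delta> \<rho>^2, whereas \<open>ul\<close> bounds u l
    by that value.\<close>
  have "ereal (m' + \<delta> * ((cmod l)\<^sup>2 + \<rho>\<^sup>2)) = circle_mean (\<lambda>w. ereal (m' + \<delta> * (cmod w)\<^sup>2)) l \<rho>"
    using \<rho>(1) by (simp add: circle_mean_cmod_square)
  also have "\<dots> \<le> circle_mean u l \<rho>"
  proof (rule circle_mean_mono)
    fix w assume "w \<in> sphere l \<rho>"
    then have "w \<in> \<Omega>" using \<rho> by auto
    then have "ereal m' \<le> W w" using m'(1) unfolding m_def using INF_lower[of w \<Omega> W] by simp
    then show "ereal (m' + \<delta> * (cmod w)\<^sup>2) \<le> u w" unfolding W_def by (cases "u w") auto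
  qed (use \<rho> in simp)
  also have "\<dots> \<le> u l" using hyp \<rho> unfolding hyperharmonic_on_def by blast
  also note ul
  finally have "\<delta> * \<rho>\<^sup>2 \<le> 0" by (simp add: algebra_simps)
  moreover have "0 < \<delta> * \<rho>\<^sup>2" using \<delta>(1) \<rho>(1) by simp
  ultimately show False by linarith
qed

section \<open>Points whose N-th power is near 1\<close>

text \<open>Dividing \<open>w\<close> by exp (\<zeta> / N), the N-th root of w^N near 1, yields an
  exact root of unity; logarithm and exponential are both Lipschitz near the relevant
  points.\<close>

lemma dist_root_unity_le:
  fixes w :: complex
  assumes "4 \<le> N" "cmod (w ^ N - 1) < 1 / 2"
  obtains \<omega> where "\<omega> ^ N = 1" "cmod (w - \<omega>) \<le> cmod (w ^ N - 1)"
proof -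
  define y where "y = w ^ N - 1"
  define \<zeta> where "\<zeta> = Ln (1 + y)"
  define \<omega> where "\<omega> = w * exp (- (\<zeta> / N))"
  have "w ^ N \<noteq> 0"
  proof
    assume "w ^ N = 0"
    with assms(2) show False by simp
  qed
  then have "exp \<zeta> = w ^ N" unfolding \<zeta>_def y_def by simp
  have \<omega>: "\<omega> ^ N = 1"
  proof -
    have "\<omega> ^ N = w ^ N * exp (N * (- (\<zeta> / N)))"
      unfolding \<omega>_def power_mult_distrib exp_of_nat_mult by simp
    also have "\<dots> = 1" using assms(1) \<open>exp \<zeta> = w ^ N\<close>[symmetric] by (simp add: exp_minus)
    finally show ?thesis .
  qed
  then have "cmod \<omega> = 1" using assms(1) power_eq_1_iff by fastforce
  have \<zeta>: "cmod \<zeta> \<le> 2 * cmod y"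
    unfolding \<zeta>_def using assms(2) by (intro norm_Ln_le) (simp add: y_def)
  \<comment> \<open>Here N \<ge> 4 turns the constant 2 of the logarithm estimate into 1/2, so the
    constant 3/2 of the exponential estimate still leaves at most |y|.\<close>
  have \<zeta>N: "cmod (\<zeta> / N) \<le> cmod y / 2"
  proof -
    have "cmod (\<zeta> / N) = cmod \<zeta> / N" by (simp add: norm_divide)
    also have "\<dots> \<le> cmod \<zeta> / 4" using assms(1) by (intro divide_left_mono) auto
    finally show ?thesis using \<zeta> by simp
  qed
  have "w - \<omega> = \<omega> * (exp (\<zeta> / N) - 1)"
    unfolding \<omega>_def by (simp add: algebra_simps exp_minus)
  then have "cmod (w - \<omega>) = cmod (exp (\<zeta> / N) - 1)" using \<open>cmod \<omega> = 1\<close> by (simp add: norm_mult)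
  also have "\<dots> \<le> 3 / 2 * cmod (\<zeta> / N)"
    using \<zeta>N assms(2) by (intro norm_exp_bounds(2)) (simp add: y_def)
  also have "\<dots> \<le> cmod y" using \<zeta>N norm_ge_zero[of y] by linarith
  finally show thesis using that \<omega> by (simp add: y_def)
qed

section \<open>Bounding harmonic measure by competitors\<close>

lemma tendsto_imp_le_Liminf:
  fixes f :: "'a \<Rightarrow> 'b :: {complete_linorder, linorder_topology}"
  assumes "(f \<longlongrightarrow> l) F"
  shows "l \<le> Liminf F f"
  unfolding le_Liminf_iff using order_tendstoD(1)[OF assms] by blast

text \<open>Such a \<open>u\<close> is a member of the upper class over which the infimum is taken:
  nonnegativity supplies both the lower bound and the boundary inequality off
  \<open>A\<close>.\<close>

lemma harmonic_measure_le:
  assumes "hyperharmonic_on \<Omega> u" "\<And>w. w \<in> \<Omega> \<Longrightarrow> 0 \<le> u w"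
    and "\<And>\<zeta>. \<zeta> \<in> A \<Longrightarrow> 1 \<le> Liminf (at \<zeta> within \<Omega>) u"
  shows "harmonic_measure \<Omega> z A \<le> u z"
proof -
  have "u \<in> upper_class \<Omega> (indicator A)"
    unfolding upper_class_def
  proof (intro CollectI conjI ballI)
    show "\<exists>b. \<forall>z\<in>\<Omega>. ereal b \<le> u z"
      using assms(2) by (intro exI[of _ 0]) (simp add: zero_ereal_def[symmetric])
    fix \<zeta>
    have "0 \<le> Liminf (at \<zeta> within \<Omega>) u"
      by (rule Liminf_bounded) (use assms(2) in \<open>auto simp: eventually_at_filter\<close>)
    then show "indicator A \<zeta> \<le> Liminf (at \<zeta> within \<Omega>) u"
      using assms(3) by (auto simp: indicator_def)
  qed (fact assms(1))
  then show ?thesis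
    unfolding harmonic_measure_def upper_solution_def by (rule INF_lower)
qed

text \<open>The minimum principle applies to every member of the upper class, since its boundary
  data are nonnegative.\<close>

lemma harmonic_measure_nonneg:
  assumes "open \<Omega>" "bounded \<Omega>" "z \<in> \<Omega>"
  shows "0 \<le> harmonic_measure \<Omega> z A"
  unfolding harmonic_measure_def upper_solution_def
proof (rule INF_greatest)
  fix u assume "u \<in> upper_class \<Omega> (indicator A)"
  then obtain b where u: "hyperharmonic_on \<Omega> u" "\<And>w. w \<in> \<Omega> \<Longrightarrow> ereal b \<le> u w"
      "\<And>\<zeta>. \<zeta> \<in> frontier \<Omega> \<Longrightarrow> indicator A \<zeta> \<le> Liminf (at \<zeta> within \<Omega>) u"
    unfolding upper_class_def by blast
  show "0 \<le> u z"
  proof (rule hyperharmonic_nonneg[OF u(1) assms(1,2) u(2)])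
    fix \<zeta> assume "\<zeta> \<in> frontier \<Omega>"
    moreover have "(0::ereal) \<le> indicator A \<zeta>" by (simp add: indicator_def)
    ultimately show "0 \<le> Liminf (at \<zeta> within \<Omega>) u" using u(3) order_trans by blast
  qed (use assms(3) in auto)
qed

text \<open>Supplies the competitors. These functions are continuous and satisfy the mean value
  property with equality, for either sign of \<open>b\<close>.\<close>

lemma hyperharmonic_on_ln_cmod_holomorphic:
  assumes "open U" "\<Omega> \<subseteq> U" "f holomorphic_on U" "\<And>w. w \<in> U \<Longrightarrow> f w \<noteq> 0"
  shows "hyperharmonic_on \<Omega> (\<lambda>w. ereal (a + b * ln (cmod (f w))))"
  unfolding hyperharmonic_on_def
proof (intro conjI ballI allI impI)
  fix w assume "w \<in> \<Omega>"
  then have "w \<in> U" using assms(2) by blast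
  then have "isCont f w"
    using holomorphic_on_imp_continuous_on[OF assms(3)] assms(1)
    by (simp add: continuous_on_eq_continuous_at)
  then have "(f \<longlongrightarrow> f w) (at w within \<Omega>)"
    using continuous_at_imp_continuous_at_within continuous_within by blast
  then have "((\<lambda>w. ereal (a + b * ln (cmod (f w)))) \<longlongrightarrow> ereal (a + b * ln (cmod (f w)))) (at w within \<Omega>)"
    using assms(4)[OF \<open>w \<in> U\<close>] by (intro tendsto_intros) auto
  then show "ereal (a + b * ln (cmod (f w)))
      \<le> Liminf (at w within \<Omega>) (\<lambda>w. ereal (a + b * ln (cmod (f w))))"
    by (rule tendsto_imp_le_Liminf)
next
  fix w and \<rho> :: real assume "0 < \<rho>" "cball w \<rho> \<subseteq> \<Omega>"
  then have "circle_mean (\<lambda>w. ereal (a + b * ln (cmod (f w)))) w \<rho> = ereal (a + b * ln (cmod (f w)))"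
    using assms by (intro circle_mean_ln_cmod_holomorphic) auto
  then show "circle_mean (\<lambda>w. ereal (a + b * ln (cmod (f w)))) w \<rho> \<le> ereal (a + b * ln (cmod (f w)))"
    by simp
qed simp

section \<open>Harmonic measure seen from inside one ring\<close>

text \<open>After rescaling by \<rho>, a smaller value would put \<open>v\<close> within
  \<open>s\<close> of a root of unity, hence \<open>w\<close> within \<rho> s \<le> s of the centre
  of one of the discs.\<close>

lemma cmod_power_diff_ge:
  fixes w :: complex
  assumes "4 \<le> N" "0 < \<rho>" "\<rho> \<le> 1" "s \<le> 1 / 2"
    and "\<And>\<omega>. \<omega> ^ N = 1 \<Longrightarrow> w \<notin> cball (of_real \<rho> * \<omega>) s"
  shows "\<rho> ^ N * s \<le> cmod (w ^ N - of_real \<rho> ^ N)"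
proof (rule ccontr)
  assume less: "\<not> ?thesis"
  define v where "v = w / of_real \<rho>"
  have w: "w = of_real \<rho> * v" using assms(2) by (simp add: v_def)
  have "cmod (w ^ N - of_real \<rho> ^ N) = cmod (of_real \<rho> ^ N * (v ^ N - 1))"
    by (simp add: w power_mult_distrib algebra_simps)
  also have "\<dots> = \<rho> ^ N * cmod (v ^ N - 1)"
    using assms(2) by (simp add: norm_mult norm_power)
  finally have v: "cmod (v ^ N - 1) < s" using less assms(2) by (simp add: not_le)
  then obtain \<omega> where \<omega>: "\<omega> ^ N = 1" "cmod (v - \<omega>) \<le> cmod (v ^ N - 1)"
    using dist_root_unity_le[of N v] assms(1,4) by auto
  have "dist (of_real \<rho> * \<omega>) w = \<rho> * cmod (v - \<omega>)"
    using assms(2) by (simp add: w dist_norm norm_mult norm_minus_commute flip: right_diff_distrib)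
  also have "\<dots> \<le> 1 * cmod (v - \<omega>)" using assms(3) by (intro mult_right_mono) auto
  also have "\<dots> \<le> s" using \<omega>(2) v by simp
  finally show False using assms(5)[OF \<omega>(1)] by simp
qed

text \<open>The competitor \<open>v\<close> rescales ln |f| affinely: it is 0 where |f| = \<rho>^N
  s, the lower bound off the discs, and 1 where |f| = 1/2, a lower bound on the unit circle.\<close>

lemma harmonic_measure_ring_le:
  fixes \<Omega> :: "complex set"
  assumes N: "4 \<le> N" and \<rho>: "0 < \<rho>" "\<rho> < 1" "\<rho> ^ N \<le> 1 / 2" and s: "0 < s" "s \<le> 1 / 2"
    and disj: "\<And>\<omega>. \<omega> ^ N = 1 \<Longrightarrow> cball (of_real \<rho> * \<omega>) s \<inter> \<Omega> = {}"
    and z: "z \<in> \<Omega>" "cmod z \<le> \<rho>"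
  shows "harmonic_measure \<Omega> z (sphere 0 1)
    \<le> ereal ((ln 2 - ln s) / (- ln (\<rho> ^ N * s) - ln 2))"
proof -
  define f where "f = (\<lambda>w::complex. w ^ N - of_real \<rho> ^ N)"
  define D where "D = - ln (\<rho> ^ N * s) - ln 2"
  define v where "v = (\<lambda>w. - ln (\<rho> ^ N * s) / D + 1 / D * ln (cmod (f w)))"
  have v_eq: "v w = (ln (cmod (f w)) - ln (\<rho> ^ N * s)) / D" for w
    by (simp add: v_def diff_divide_distrib)
  have pos: "0 < \<rho> ^ N * s" using \<rho> s by simp
  have "\<rho> ^ N * s \<le> 1 / 2 * (1 / 2)" using \<rho> s by (intro mult_mono) auto
  then have "ln (\<rho> ^ N * s) < ln (1 / 2)" using pos by (subst ln_less_cancel_iff) auto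
  then have D: "0 < D" by (simp add: D_def ln_div)
  have lower: "\<rho> ^ N * s \<le> cmod (f w)" if "w \<in> \<Omega>" for w
    unfolding f_def
  proof (rule cmod_power_diff_ge)
    show "w \<notin> cball (of_real \<rho> * \<omega>) s" if "\<omega> ^ N = 1" for \<omega>
      using disj[OF that] \<open>w \<in> \<Omega>\<close> by blast
  qed (use \<rho> s N in auto)
  have cont: "isCont f w" for w unfolding f_def by (intro continuous_intros)
  have "hyperharmonic_on \<Omega> (\<lambda>w. ereal (v w))"
    unfolding v_def
  proof (rule hyperharmonic_on_ln_cmod_holomorphic)
    show "open {w. f w \<noteq> 0}"
      using cont by (intro open_Collect_neq) (auto intro: continuous_at_imp_continuous_on)
    show "\<Omega> \<subseteq> {w. f w \<noteq> 0}" using lower pos by fastforce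
    show "f holomorphic_on {w. f w \<noteq> 0}" unfolding f_def by (intro holomorphic_intros)
  qed auto
  moreover have "0 \<le> ereal (v w)" if "w \<in> \<Omega>" for w
  proof -
    have "ln (\<rho> ^ N * s) \<le> ln (cmod (f w))"
      using lower[OF that] pos by (subst ln_le_cancel_iff) auto
    then show ?thesis using D by (simp add: v_eq)
  qed
  moreover have "1 \<le> Liminf (at \<zeta> within \<Omega>) (\<lambda>w. ereal (v w))" if "\<zeta> \<in> sphere 0 1" for \<zeta>
  proof -
    have "cmod (of_real \<rho> ^ N) = \<rho> ^ N" using \<rho> by (simp add: norm_power)
    then have "1 - \<rho> ^ N \<le> cmod (f \<zeta>)"
      using that norm_triangle_ineq2[of "\<zeta> ^ N" "of_real \<rho> ^ N"] by (simp add: f_def norm_power)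
    then have f: "1 / 2 \<le> cmod (f \<zeta>)" using \<rho> by simp
    then have "ln (1 / 2) \<le> ln (cmod (f \<zeta>))" by (subst ln_le_cancel_iff) auto
    then have "1 \<le> v \<zeta>" using D by (simp add: v_eq ln_div D_def)
    moreover have "((\<lambda>w. ereal (v w)) \<longlongrightarrow> ereal (v \<zeta>)) (at \<zeta> within \<Omega>)"
      unfolding v_def
      using continuous_at_imp_continuous_at_within[OF cont, unfolded continuous_within] f
      by (intro tendsto_intros) auto
    ultimately show ?thesis
      using tendsto_imp_le_Liminf order_trans by (metis ereal_less_eq(3) one_ereal_def)
  qed
  ultimately have "harmonic_measure \<Omega> z (sphere 0 1) \<le> ereal (v z)"
    by (rule harmonic_measure_le)
  also have "v z \<le> (ln 2 - ln s) / D"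
  proof -
    \<comment> \<open>The power \<rho>^N cancels in ln (2 \<rho>^N) - ln (\<rho>^N s), which leaves
      the numerator ln 2 - ln s.\<close>
    have "cmod (f z) \<le> cmod z ^ N + \<rho> ^ N"
      unfolding f_def using norm_triangle_ineq4[of "z ^ N" "of_real \<rho> ^ N"] \<rho> by (simp add: norm_power)
    also have "\<dots> \<le> 2 * \<rho> ^ N" using power_mono[OF z(2), of N] by simp
    finally have "ln (cmod (f z)) \<le> ln (2 * \<rho> ^ N)"
      using lower[OF z(1)] pos by (subst ln_le_cancel_iff) auto
    then show ?thesis
      unfolding v_eq using D \<rho> s by (intro divide_right_mono) (auto simp: ln_mult)
  qed
  finally show ?thesis by (simp add: D_def)
qed

section \<open>Openness of champagne regions\<close>

text \<open>The discs accumulate only at the unit circle, so near a point of the region only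
  finitely many of these closed sets have to be removed.\<close>

lemma open_champagne:
  assumes "champagne_data x r"
  shows "open (ball 0 1 - bubbles x r)"
proof -
  have r: "\<And>k. 0 < r k" and x: "\<And>k. cmod (x k) < 1" and lim: "(\<lambda>k. cmod (x k)) \<longlonglongrightarrow> 1"
    and sup: "(SUP k. ereal (r k / (1 - cmod (x k)))) < 1"
    using assms unfolding champagne_data_def by (auto simp: dist_norm)
  have ratio: "ereal (r k / (1 - cmod (x k))) < 1" for k
    using sup by (meson SUP_upper UNIV_I order_le_less_trans)
  have small: "r k \<le> 1 - cmod (x k)" for k
    using ratio[of k] x[of k] by (simp add: one_ereal_def)
  show ?thesis
    unfolding open_subopen[of "ball 0 1 - bubbles x r"]
  proof
    fix z assume z: "z \<in> ball 0 1 - bubbles x r"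
    define a where "a = (1 + cmod z) / 2"
    have a: "cmod z < a" "a < 1" using z by (auto simp: a_def)
    \<comment> \<open>Since r k \<le> 1 - |x k|, points \<open>w\<close> of the k-th disc have |w|
      \<ge> 2 |x k| - 1, and this exceeds \<open>a\<close> beyond the threshold (1 + a) / 2.\<close>
    have "eventually (\<lambda>k. (1 + a) / 2 < cmod (x k)) sequentially"
      by (rule order_tendstoD(1)[OF lim]) (use a in simp)
    then obtain K where K: "\<And>k. K \<le> k \<Longrightarrow> (1 + a) / 2 < cmod (x k)"
      unfolding eventually_sequentially by blast
    have far: "a < cmod w" if "K \<le> k" "w \<in> cball (x k) (r k)" for k w
      using K[OF that(1)] small[of k] that(2) norm_triangle_ineq2[of "x k" w]
      by (auto simp: dist_norm)
    have "open (ball 0 a - (\<Union>k<K. cball (x k) (r k)))"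
      by (intro open_Diff closed_UN) auto
    moreover have "z \<in> ball 0 a - (\<Union>k<K. cball (x k) (r k))"
      using z a by (auto simp: bubbles_def)
    moreover have "ball 0 a - (\<Union>k<K. cball (x k) (r k)) \<subseteq> ball 0 1 - bubbles x r"
    proof
      fix w assume w: "w \<in> ball 0 a - (\<Union>k<K. cball (x k) (r k))"
      have "w \<notin> cball (x k) (r k)" for k
      proof (cases "k < K")
        case True
        then show ?thesis using w by blast
      next
        case False
        then show ?thesis using far[of k w] w by (auto simp del: mem_cball)
      qed
      then show "w \<in> ball 0 1 - bubbles x r"
        using w a(2) by (auto simp: bubbles_def simp del: mem_cball)
    qed
    ultimately show "\<exists>T. open T \<and> z \<in> T \<and> T \<subseteq> ball 0 1 - bubbles x r" by blast
  qed
qed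

section \<open>Separation of roots of unity and choice of the parameters of a ring\<close>

text \<open>The powers of the quotient \<open>q\<close> sum to 0, so N = |sum of (q^j - 1)|, where
  each of the N terms is at most N |q - 1|.\<close>

lemma dist_roots_unity_ge:
  fixes \<omega> \<omega>' :: complex
  assumes "\<omega> ^ N = 1" "\<omega>' ^ N = 1" "\<omega> \<noteq> \<omega>'" "0 < N"
  shows "1 \<le> N * dist \<omega> \<omega>'"
proof -
  define q where "q = \<omega> / \<omega>'"
  have n: "cmod \<omega>' = 1" "cmod \<omega> = 1" using assms power_eq_1_iff by blast+
  then have "\<omega>' \<noteq> 0" by auto
  have q: "q ^ N = 1" "q \<noteq> 1" "cmod q = 1"
    using assms n by (auto simp: q_def power_divide norm_divide)
  have "\<omega> - \<omega>' = (q - 1) * \<omega>'" using \<open>\<omega>' \<noteq> 0\<close> by (simp add: q_def algebra_simps)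
  then have d: "dist \<omega> \<omega>' = cmod (q - 1)" using n by (simp add: dist_norm norm_mult)
  have "(q - 1) * (\<Sum>j<N. q ^ j) = 0" using q power_diff_1_eq[of q N] by simp
  then have "(\<Sum>j<N. q ^ j) = 0" using q(2) by simp
  then have "real N = cmod (\<Sum>j<N. q ^ j - 1)" by (simp add: sum_subtractf)
  also have "\<dots> \<le> (\<Sum>j<N. cmod (q ^ j - 1))" by (rule norm_sum)
  also have "\<dots> \<le> (\<Sum>j<N. N * cmod (q - 1))"
  proof (rule sum_mono)
    fix j assume "j \<in> {..<N}"
    have "cmod (q ^ j - 1 ^ j) \<le> j * cmod (q - 1)" using q by (intro norm_power_diff) auto
    also have "\<dots> \<le> N * cmod (q - 1)" using \<open>j \<in> {..<N}\<close> by (intro mult_right_mono) auto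
    finally show "cmod (q ^ j - 1) \<le> N * cmod (q - 1)" by simp
  qed
  finally show ?thesis using assms(4) d by simp
qed

lemma filterlim_at_top_if_finite_le:
  fixes g :: "nat \<Rightarrow> nat"
  assumes "\<And>n. finite {k. g k \<le> n}"
  shows "filterlim g at_top sequentially"
  unfolding filterlim_at_top
proof
  fix Z
  have "{k. \<not> Z \<le> g k} \<subseteq> {k. g k \<le> Z}" by auto
  then have "finite {k. \<not> Z \<le> g k}" using assms finite_subset by blast
  then show "\<forall>\<^sub>F k in sequentially. Z \<le> g k"
    by (simp add: eventually_cofinite flip: cofinite_eq_sequentially)
qed

text \<open>With s = exp (-c N) and c = \<eta> ln (1/\<rho>), the final ratio is of order \<eta>
  whatever \<open>N\<close> is, while every other requirement holds for large \<open>N\<close>. The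
  function \<open>\<phi>\<close> stands for the summand in either series.\<close>

lemma ring_parameters:
  fixes \<phi> :: "real \<Rightarrow> real" and \<rho> \<eta> d e :: real
  assumes \<phi>: "\<And>c. 0 < c \<Longrightarrow> (\<lambda>N. real N * \<phi> (exp (- (c * real N)))) \<longlonglongrightarrow> 0"
    and "0 < \<rho>" "\<rho> < 1" "0 < \<eta>" "\<eta> \<le> 1" "0 < d" "0 < e"
  obtains N s where "4 \<le> N" "0 < s" "s \<le> 1 / 2" "s \<le> d" "4 * real N * s < 1" "\<rho> ^ N \<le> 1 / 2"
    "N * \<phi> s \<le> e" "(ln 2 - ln s) / (- ln (\<rho> ^ N * s) - ln 2) \<le> 2 * \<eta>"
proof -
  define L where "L = - ln \<rho>"
  define c where "c = \<eta> * L"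
  have L: "0 < L" using assms by (simp add: L_def)
  then have c: "0 < c" "c \<le> L" using assms by (auto simp: c_def mult_le_cancel_right1)
  define s where "s = (\<lambda>N::nat. exp (- (c * real N)))"
  have Ns: "(\<lambda>N. 4 * real N * s N) \<longlonglongrightarrow> 0" unfolding s_def using c(1) by real_asymp
  have s0: "s \<longlonglongrightarrow> 0" unfolding s_def using c(1) by real_asymp
  have cN: "filterlim (\<lambda>N. c * real N) at_top sequentially" using c(1) by real_asymp
  have \<rho>N: "(\<lambda>N. \<rho> ^ N) \<longlonglongrightarrow> 0" using assms by (intro LIMSEQ_realpow_zero) auto
  \<comment> \<open>The last condition 2 \<le> c N absorbs both occurrences of ln 2: the numerator
    is at most 2 c N and the denominator at least L N.\<close>
  have "\<forall>\<^sub>F N in sequentially. 4 \<le> N \<and> s N < 1 / 2 \<and> s N < d \<and> 4 * real N * s N < 1 \<and> \<rho> ^ N < 1 / 2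
      \<and> N * \<phi> (s N) < e \<and> 2 \<le> c * N"
    using \<phi>[OF c(1)] assms(6,7)
    by (intro eventually_conj eventually_ge_at_top order_tendstoD(2)[OF s0] order_tendstoD(2)[OF Ns]
        order_tendstoD(2)[OF \<rho>N])
      (auto simp: s_def intro: order_tendstoD(2) filterlim_at_top[THEN iffD1, rule_format, OF cN])
  then obtain N where N: "4 \<le> N" "s N < 1 / 2" "s N < d" "4 * real N * s N < 1" "\<rho> ^ N < 1 / 2"
      "N * \<phi> (s N) < e" "2 \<le> c * N"
    unfolding eventually_sequentially by blast
  have "c * N \<le> L * N" using c(2) by (intro mult_right_mono) auto
  have ln2: "0 < ln (2::real)" "ln (2::real) \<le> 1" using ln_le_minus_one[of 2] by auto
  have ln_s: "ln (s N) = - (c * N)" by (simp add: s_def)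
  have "- ln (\<rho> ^ N * s N) - ln 2 = L * N + c * N - ln 2"
    using assms(2) by (simp add: ln_mult ln_s ln_realpow L_def s_def algebra_simps)
  also have "\<dots> \<ge> L * N" using N ln2 by linarith
  finally have D: "L * N \<le> - ln (\<rho> ^ N * s N) - ln 2" .
  have "0 < L * N" using \<open>c * N \<le> L * N\<close> N by linarith
  have "(ln 2 - ln (s N)) / (- ln (\<rho> ^ N * s N) - ln 2) \<le> (2 * (c * N)) / (L * N)"
    using D \<open>0 < L * N\<close> N ln2 ln_s by (intro frac_le) auto
  also have "\<dots> = 2 * \<eta>" using L N(1) by (simp add: c_def)
  finally show thesis using N by (intro that[of N "s N"]) (auto simp: s_def)
qed

text \<open>The centres are at least \<rho> / N \<ge> 1 / (2 N) > 2 s apart.\<close>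

lemma disjoint_cball_ring:
  fixes \<omega> \<omega>' :: complex
  assumes "\<omega> ^ N = 1" "\<omega>' ^ N = 1" "\<omega> \<noteq> \<omega>'" "0 < N" "1 / 2 \<le> \<rho>" "4 * real N * s < 1"
  shows "cball (of_real \<rho> * \<omega>) s \<inter> cball (of_real \<rho> * \<omega>') s = {}"
proof -
  have "dist (of_real \<rho> * \<omega>) (of_real \<rho> * \<omega>') = \<rho> * dist \<omega> \<omega>'"
    using assms(5) by (simp add: dist_norm norm_mult flip: right_diff_distrib)
  moreover have "1 / 2 * dist \<omega> \<omega>' \<le> \<rho> * dist \<omega> \<omega>'"
    using assms(5) by (intro mult_right_mono) auto
  moreover have "4 * s < dist \<omega> \<omega>'"
  proof -
    have "N * (4 * s) < N * dist \<omega> \<omega>'"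
      using assms(6) dist_roots_unity_ge[OF assms(1-4)] by (simp add: mult_ac)
    then show ?thesis using assms(4) by simp
  qed
  ultimately have "s + s < dist (of_real \<rho> * \<omega>) (of_real \<rho> * \<omega>')" by linarith
  then show ?thesis by (rule disjoint_cballI)
qed

section \<open>Assembling infinitely many rings\<close>

lemma ex_unavoidable_champagne:
  fixes \<phi> :: "real \<Rightarrow> real" and \<epsilon> :: real
  assumes \<phi>_nonneg: "\<And>t. 0 \<le> \<phi> t" and "0 < \<epsilon>"
    and \<phi>: "\<And>c. 0 < c \<Longrightarrow> (\<lambda>N. real N * \<phi> (exp (- (c * real N)))) \<longlonglongrightarrow> 0"
  shows "\<exists>x r. champagne_data x r \<and> summable (\<lambda>k. \<phi> (r k)) \<and> (\<Sum>k. \<phi> (r k)) < \<epsilon>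
    \<and> unavoidable (bubbles x r)"
proof -
  \<comment> \<open>\<open>d n\<close> is the distance of ring \<open>n\<close> from the unit
    circle. As these numbers sum to 1, they also serve as weights for distributing \<epsilon>/2 over
    the rings.\<close>
  define d where "d = (\<lambda>n::nat. (1 / 2 :: real) ^ Suc n)"
  define \<rho> where "\<rho> = (\<lambda>n. 1 - d n)"
  have d: "0 < d n" "d n \<le> 1 / 2" for n
    using power_decreasing[of 1 "Suc n" "1 / 2 :: real"] by (auto simp: d_def)
  then have \<rho>: "1 / 2 \<le> \<rho> n" "\<rho> n < 1" for n by (auto simp: \<rho>_def)
  have d0: "d \<longlonglongrightarrow> 0"
    unfolding d_def by (intro LIMSEQ_Suc LIMSEQ_realpow_zero) auto
  have \<rho>1: "\<rho> \<longlonglongrightarrow> 1"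
    unfolding \<rho>_def using tendsto_diff[OF tendsto_const[of 1] d0] by simp
  \<comment> \<open>Ring \<open>n\<close> gets \<eta> = 1 / (n + 1), which tends to 0. The bound d n
    / 8 on the radius keeps the rings apart and their discs well inside the unit disc.\<close>
  have "\<exists>N s. 4 \<le> N \<and> 0 < s \<and> s \<le> 1 / 2 \<and> s \<le> d n / 8 \<and> 4 * real N * s < 1 \<and> \<rho> n ^ N \<le> 1 / 2
      \<and> N * \<phi> s \<le> \<epsilon> / 2 * d n
      \<and> (ln 2 - ln s) / (- ln (\<rho> n ^ N * s) - ln 2) \<le> 2 * (1 / Suc n)" for n
    by (rule ring_parameters[of \<phi> "\<rho> n" "1 / Suc n" "d n / 8" "\<epsilon> / 2 * d n", OF \<phi>])
      (use \<rho>[of n] d(1)[of n] \<open>0 < \<epsilon>\<close> in \<open>auto simp del: of_nat_Suc\<close>)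
  then obtain N s where N: "\<And>n. 4 \<le> N n" and s: "\<And>n. 0 < s n" "\<And>n. s n \<le> 1 / 2" "\<And>n. s n \<le> d n / 8"
      and Ns: "\<And>n. 4 * real (N n) * s n < 1" "\<And>n. \<rho> n ^ N n \<le> 1 / 2"
      and sum: "\<And>n. N n * \<phi> (s n) \<le> \<epsilon> / 2 * d n"
      and hm: "\<And>n. (ln 2 - ln (s n)) / (- ln (\<rho> n ^ N n * s n) - ln 2) \<le> 2 * (1 / Suc n)"
    by metis
  define Z where "Z = (\<lambda>n. {\<omega>::complex. \<omega> ^ N n = 1})"
  have Z: "finite (Z n)" "card (Z n) = N n" for n
    using card_complex_roots_unity[of "N n"] finite_roots_unity[of "N n"] N[of n]
    by (auto simp: Z_def)
  \<comment> \<open>Pairs of a ring number and a root of unity index the discs; \<open>E\<close>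
    lists them as a sequence, in which \<open>g k\<close> is the ring of the k-th disc.\<close>
  define I where "I = Sigma UNIV Z"
  have "infinite I"
  proof
    assume "finite I"
    then have "finite (fst ` I)" by simp
    moreover have "fst ` I = UNIV"
      by (auto simp: I_def Z_def image_iff intro!: exI[of _ "1::complex"])
    ultimately show False by simp
  qed
  moreover have "countable I"
    unfolding I_def using Z by (intro countable_SIGMA) (auto intro: countable_finite)
  ultimately obtain E where E: "bij_betw E (UNIV :: nat set) I"
    using bij_betw_from_nat_into by blast
  define g where "g = (\<lambda>k. fst (E k))"
  define \<omega> where "\<omega> = (\<lambda>k. snd (E k))"
  define x where "x = (\<lambda>k. of_real (\<rho> (g k)) * \<omega> k)"
  define r where "r = (\<lambda>k. s (g k))"
  have \<omega>: "\<omega> k ^ N (g k) = 1" for k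
    using bij_betw_apply[OF E UNIV_I, of k] by (auto simp: I_def Z_def \<omega>_def g_def)
  have "cmod (\<omega> k) = 1" for k
    using power_eq_1_iff[OF \<omega>[of k]] N[of "g k"] by auto
  then have x: "cmod (x k) = \<rho> (g k)" for k
    using \<rho>(1)[of "g k"] by (simp add: x_def norm_mult)
  \<comment> \<open>Each ring is finite, so in whatever order \<open>E\<close> lists the discs, the
    ring numbers tend to infinity.\<close>
  have "finite {k. g k \<le> n}" for n
  proof -
    have "finite (Sigma {..n} Z)" using Z by auto
    moreover have "E ` {k. g k \<le> n} \<subseteq> Sigma {..n} Z"
    proof (rule image_subsetI)
      fix k assume "k \<in> {k. g k \<le> n}"
      then show "E k \<in> Sigma {..n} Z"
        using bij_betw_apply[OF E UNIV_I, of k] by (auto simp: I_def g_def)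
    qed
    ultimately have "finite (E ` {k. g k \<le> n})" by (rule finite_subset[rotated])
    moreover have "inj_on E {k. g k \<le> n}"
      using E by (meson bij_betw_imp_inj_on inj_on_subset subset_UNIV)
    ultimately show ?thesis by (simp add: finite_image_iff)
  qed
  then have g: "filterlim g at_top sequentially" by (rule filterlim_at_top_if_finite_le)

  \<comment> \<open>The radial gap d (g k) - d (g j) is at least d (g k) / 2, while the two radii
    add up to at most 3/16 of d (g k).\<close>
  have disj_rings: "cball (x k) (r k) \<inter> cball (x j) (r j) = {}" if "g k < g j" for k j
  proof (rule disjoint_cballI)
    have "d (g j) \<le> d (g k) / 2"
      using that power_decreasing[of "Suc (g k)" "g j" "1 / 2 :: real"] by (simp add: d_def)
    moreover have "\<rho> (g j) - \<rho> (g k) \<le> dist (x k) (x j)"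
      using norm_triangle_ineq2[of "x j" "x k"] by (simp add: x dist_norm norm_minus_commute)
    ultimately show "r k + r j < dist (x k) (x j)"
      using s(3)[of "g k"] s(3)[of "g j"] d(1)[of "g k"] by (simp add: r_def \<rho>_def)
  qed
  have "disjoint_family (\<lambda>k. cball (x k) (r k))"
    unfolding disjoint_family_on_def
  proof (intro ballI impI)
    fix k j :: nat assume "k \<noteq> j"
    consider "g k < g j" | "g j < g k" | "g k = g j" by linarith
    then show "cball (x k) (r k) \<inter> cball (x j) (r j) = {}"
    proof cases
      case 3
      have "E k \<noteq> E j" using E \<open>k \<noteq> j\<close> by (auto simp: bij_betw_def inj_def)
      then have "\<omega> k \<noteq> \<omega> j" using 3 by (simp add: g_def \<omega>_def prod_eq_iff)
      then have "cball (of_real (\<rho> (g j)) * \<omega> k) (s (g j)) \<inter> cball (of_real (\<rho> (g j)) * \<omega> j) (s (g j)) = {}"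
        using \<omega>[of k] \<omega>[of j] 3 N[of "g j"] \<rho>(1) Ns(1)
        by (intro disjoint_cball_ring[where N = "N (g j)"]) auto
      then show ?thesis by (simp add: x_def r_def 3)
    qed (use disj_rings in blast)+
  qed
  moreover have "(\<lambda>k. cmod (x k)) \<longlonglongrightarrow> 1"
    unfolding x by (rule filterlim_compose[OF \<rho>1 g])
  moreover have "(SUP k. ereal (r k / (1 - cmod (x k)))) < 1"
  proof -
    have "(SUP k. ereal (r k / (1 - cmod (x k)))) \<le> ereal (1 / 8)"
      using s(3) d(1) by (intro SUP_least) (simp add: x r_def \<rho>_def divide_le_eq)
    also have "\<dots> < 1" by (simp add: one_ereal_def)
    finally show ?thesis .
  qed
  moreover have "0 \<in> ball 0 1 - bubbles x r"
  proof -
    have "r k < cmod (x k)" for k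
      using s(3)[of "g k"] d(2)[of "g k"] \<rho>(1)[of "g k"] unfolding x r_def by linarith
    then show ?thesis by (auto simp: bubbles_def not_le)
  qed
  ultimately have champ: "champagne_data x r"
    unfolding champagne_data_def using s(1) \<rho>(2) by (simp add: x r_def)

  \<comment> \<open>The series is summed unconditionally over the pairs, ring by ring, and then
    carried to the order given by \<open>E\<close>. The bound \<epsilon>/2 leaves room for the
    strict inequality.\<close>
  define F where "F = (\<lambda>p::nat \<times> complex. \<phi> (s (fst p)))"
  have inner: "((\<lambda>\<omega>. F (n, \<omega>)) has_sum (N n * \<phi> (s n))) (Z n)" for n
    using has_sum_finite[OF Z(1), of "\<lambda>\<omega>. F (n, \<omega>)" n] by (simp add: F_def Z(2))
  have geo: "((\<lambda>n. \<epsilon> / 2 * d n) has_sum (\<epsilon> / 2)) UNIV"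
  proof -
    have "(\<lambda>n. \<epsilon> / 2 * d n) sums (\<epsilon> / 2 * 1)"
      unfolding d_def by (intro sums_mult power_half_series)
    then show ?thesis
      using \<open>0 < \<epsilon>\<close> d(1)[THEN less_imp_le] by (intro sums_nonneg_imp_has_sum) auto
  qed
  have outer: "(\<lambda>n. N n * \<phi> (s n)) summable_on UNIV"
    by (rule summable_on_comparison_test[OF has_sum_imp_summable[OF geo]])
      (use sum \<phi>_nonneg in auto)
  have FI: "F summable_on I"
    unfolding I_def by (rule summable_on_SigmaI[OF inner outer]) (simp add: F_def \<phi>_nonneg)
  have "infsum F I = (\<Sum>\<^sub>\<infinity>n. N n * \<phi> (s n))"
    using infsum_Sigma_banach[OF FI[unfolded I_def]] infsumI[OF inner] by (simp add: I_def)
  also have "\<dots> \<le> \<epsilon> / 2"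
    using infsum_mono[OF outer has_sum_imp_summable[OF geo]] sum infsumI[OF geo] by simp
  finally have FI_le: "infsum F I \<le> \<epsilon> / 2" .
  have "(\<lambda>k. F (E k)) summable_on UNIV"
    using FI summable_on_reindex_bij_betw[OF E] by blast
  moreover have "(\<Sum>\<^sub>\<infinity>k. F (E k)) = infsum F I"
    by (rule infsum_reindex_bij_betw[OF E])
  moreover have "F (E k) = \<phi> (r k)" for k by (simp add: F_def r_def g_def)
  ultimately have \<phi>r: "(\<lambda>k. \<phi> (r k)) summable_on UNIV" "(\<Sum>\<^sub>\<infinity>k. \<phi> (r k)) \<le> \<epsilon> / 2"
    using FI_le by auto
  then have "summable (\<lambda>k. \<phi> (r k))" by (simp add: summable_on_imp_summable)
  moreover have "(\<Sum>k. \<phi> (r k)) < \<epsilon>"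
    using \<phi>r \<open>0 < \<epsilon>\<close> has_sum_imp_sums[OF has_sum_infsum[OF \<phi>r(1)]] by (simp add: sums_iff)

  moreover have "unavoidable (bubbles x r)"
    unfolding unavoidable_def
  proof
    let ?\<Omega> = "ball 0 1 - bubbles x r"
    fix z assume z: "z \<in> ?\<Omega>"
    \<comment> \<open>A single ring suffices for each \<open>e\<close>: one far enough out to
      surround \<open>z\<close> and with 2 / (n + 1) < e.\<close>
    have "harmonic_measure ?\<Omega> z (sphere 0 1) \<le> 0 + ereal e" if "0 < e" for e
    proof -
      have "(\<lambda>n. 2 * (1 / real (Suc n))) \<longlonglongrightarrow> 0" by real_asymp
      then have "\<forall>\<^sub>F n in sequentially. 2 * (1 / real (Suc n)) < e \<and> cmod z < \<rho> n"
        using \<open>0 < e\<close> z by (intro eventually_conj order_tendstoD(2)[of _ 0] order_tendstoD(1)[OF \<rho>1]) auto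
      then obtain n where n: "2 * (1 / real (Suc n)) < e" "cmod z < \<rho> n"
        unfolding eventually_sequentially by blast
      have disj: "cball (of_real (\<rho> n) * \<zeta>) (s n) \<inter> ?\<Omega> = {}" if \<zeta>: "\<zeta> ^ N n = 1" for \<zeta>
      proof -
        have "(n, \<zeta>) \<in> I" using \<zeta> by (simp add: I_def Z_def)
        then obtain k where "E k = (n, \<zeta>)" using E by (force simp: bij_betw_def)
        then have "cball (of_real (\<rho> n) * \<zeta>) (s n) = cball (x k) (r k)"
          by (simp add: x_def r_def g_def \<omega>_def)
        then show ?thesis by (auto simp: bubbles_def)
      qed
      have "harmonic_measure ?\<Omega> z (sphere 0 1)
          \<le> ereal ((ln 2 - ln (s n)) / (- ln (\<rho> n ^ N n * s n) - ln 2))"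
        by (rule harmonic_measure_ring_le[OF N _ \<rho>(2) Ns(2) s(1,2) disj z])
          (use \<rho>(1)[of n] n in auto)
      also have "\<dots> \<le> ereal e" using hm[of n] n by simp
      finally show ?thesis by simp
    qed
    then have "harmonic_measure ?\<Omega> z (sphere 0 1) \<le> 0"
      by (rule ereal_le_epsilon2)
    moreover have "0 \<le> harmonic_measure ?\<Omega> z (sphere 0 1)"
      by (rule harmonic_measure_nonneg[OF open_champagne[OF champ] _ z]) (simp add: bounded_diff)
    ultimately show "harmonic_measure ?\<Omega> z (sphere 0 1) = 0" by (rule antisym)
  qed
  ultimately show ?thesis using champ by blast
qed

theorem corollary1p3:
  fixes \<epsilon> :: real
  assumes "\<epsilon> > 0"
  shows "(\<forall>\<alpha>::real. \<alpha> > 0 \<longrightarrow>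
            (\<exists>x r. champagne_data x r \<and>
               summable (\<lambda>k. r k powr \<alpha>) \<and> (\<Sum>k. r k powr \<alpha>) < \<epsilon> \<and>
               unavoidable (bubbles x r))) \<and>
         (\<forall>\<alpha>::real. \<alpha> > 1 \<longrightarrow>
            (\<exists>x r. champagne_data x r \<and>
               summable (\<lambda>k. ln (1 / r k) powr (- \<alpha>)) \<and>
               (\<Sum>k. ln (1 / r k) powr (- \<alpha>)) < \<epsilon> \<and>
               unavoidable (bubbles x r)))"
proof (intro conjI allI impI)
  fix \<alpha> :: real assume "\<alpha> > 0"
  \<comment> \<open>Exponentially small radii beat the factor \<open>N\<close> for every positive
    power.\<close>
  have "(\<lambda>N. real N * exp (- (c * real N)) powr \<alpha>) \<longlonglongrightarrow> 0" if "0 < c" for c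
    using that \<open>\<alpha> > 0\<close> by real_asymp
  then show "\<exists>x r. champagne_data x r \<and> summable (\<lambda>k. r k powr \<alpha>) \<and> (\<Sum>k. r k powr \<alpha>) < \<epsilon> \<and>
      unavoidable (bubbles x r)"
    using assms by (intro ex_unavoidable_champagne[of "\<lambda>t. t powr \<alpha>"]) auto
next
  fix \<alpha> :: real assume "\<alpha> > 1"
  \<comment> \<open>Here ln (1/s) = c N, so the expression is of order N^(1 - \<alpha>), which tends
    to 0 because \<alpha> > 1.\<close>
  have "(\<lambda>N. real N * ln (1 / exp (- (c * real N))) powr (- \<alpha>)) \<longlonglongrightarrow> 0" if "0 < c" for c
  proof -
    have "(\<lambda>N. real N * (c * real N) powr (- \<alpha>)) \<longlonglongrightarrow> 0"
      using that \<open>\<alpha> > 1\<close> by real_asymp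
    then show ?thesis by (simp add: ln_div)
  qed
  then show "\<exists>x r. champagne_data x r \<and> summable (\<lambda>k. ln (1 / r k) powr (- \<alpha>)) \<and>
      (\<Sum>k. ln (1 / r k) powr (- \<alpha>)) < \<epsilon> \<and> unavoidable (bubbles x r)"
    using assms by (intro ex_unavoidable_champagne[of "\<lambda>t. ln (1 / t) powr (- \<alpha>)"]) auto
qed

end
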